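(* Let $G$ be a simple graph on $n$ vertices and $2cn^2$ edges. Then there is a strong $1$-immersion in $G$ of a complete graph on at least $c^2 n$ vertices.
   Context: All graphs are finite; $n$ is a positive integer and $c$ is the nonnegative real number for which $|E(G)|=2cn^2$. An immersion of a graph $H$ into a graph $G$ is a one-to-one map $\phi:V(H)\to V(G)$ together with a path $P_{uv}$ in $G$ joining $\phi(u)$ and $\phi(v)$ for each edge $uv\in E(H)$, such that the paths $P_{uv}$, $uv\in E(H)$, are pairwise edge-disjoint. The immersion is strong if every path $P_{uv}$ is internally disjoint from $\phi(V(H))$. A $k$-immersion is an immersion in which each of the paths $P_{uv}$ has exactly $k$ internal vertices; so in a $1$-immersion every path has length exactly $2$. *)

theory Defs
  imports Complex_Main "HOL-Library.Disjoint_Sets"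
begin

record 'a ugraph =
  verts :: "'a set"
  edges :: "'a set set"

text \<open>Edges are unordered pairs, so there are no loops and no multiple edges.\<close>

definition simple_graph :: "'a ugraph \<Rightarrow> bool" where
  "simple_graph G \<longleftrightarrow> finite (verts G) \<and> (\<forall>e \<in> edges G. e \<subseteq> verts G \<and> card e = 2)"

definition complete_graph :: "'a ugraph \<Rightarrow> bool" where
  "complete_graph G \<longleftrightarrow> simple_graph G \<and>
     (\<forall>u \<in> verts G. \<forall>v \<in> verts G. u \<noteq> v \<longrightarrow> {u, v} \<in> edges G)"

text \<open>A path is given by the list of its vertices in the order of traversal.\<close>

definition path_edges :: "'a list \<Rightarrow> 'a set set" where
  "path_edges p = {{p ! i, p ! Suc i} | i. Suc i < length p}"

definition is_path :: "'a ugraph \<Rightarrow> 'a list \<Rightarrow> bool" where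
  "is_path G p \<longleftrightarrow> p \<noteq> [] \<and> distinct p \<and> set p \<subseteq> verts G \<and> path_edges p \<subseteq> edges G"

definition path_joins :: "'a list \<Rightarrow> 'a \<Rightarrow> 'a \<Rightarrow> bool" where
  "path_joins p x y \<longleftrightarrow> (hd p = x \<and> last p = y) \<or> (hd p = y \<and> last p = x)"

definition internal_verts :: "'a list \<Rightarrow> 'a set" where
  "internal_verts p = set (butlast (tl p))"

text \<open>The paths are indexed by the (unordered) edges of \<open>H\<close>, one path per edge;
  the direction in which the list \<open>P {u, v}\<close> traverses its path is immaterial.\<close>

definition immersion ::
    "'b ugraph \<Rightarrow> 'a ugraph \<Rightarrow> ('b \<Rightarrow> 'a) \<Rightarrow> ('b set \<Rightarrow> 'a list) \<Rightarrow> bool" where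
  "immersion H G \<phi> P \<longleftrightarrow>
     inj_on \<phi> (verts H) \<and> \<phi> ` verts H \<subseteq> verts G \<and>
     (\<forall>u v. {u, v} \<in> edges H \<longrightarrow>
        is_path G (P {u, v}) \<and> path_joins (P {u, v}) (\<phi> u) (\<phi> v)) \<and>
     disjoint_family_on (\<lambda>e. path_edges (P e)) (edges H)"

definition strong_immersion ::
    "'b ugraph \<Rightarrow> 'a ugraph \<Rightarrow> ('b \<Rightarrow> 'a) \<Rightarrow> ('b set \<Rightarrow> 'a list) \<Rightarrow> bool" where
  "strong_immersion H G \<phi> P \<longleftrightarrow> immersion H G \<phi> P \<and>
     (\<forall>e \<in> edges H. internal_verts (P e) \<inter> \<phi> ` verts H = {})"

definition k_immersion ::
    "nat \<Rightarrow> 'b ugraph \<Rightarrow> 'a ugraph \<Rightarrow> ('b \<Rightarrow> 'a) \<Rightarrow> ('b set \<Rightarrow> 'a list) \<Rightarrow> bool" where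
  "k_immersion k H G \<phi> P \<longleftrightarrow> immersion H G \<phi> P \<and>
     (\<forall>e \<in> edges H. card (internal_verts (P e)) = k)"

end

theory Submission
  imports Defs
begin

text \<open>
  A strong \<open>1\<close>-immersion of a complete graph with branch set \<open>T\<close> amounts to a choice of a common
  neighbour \<open>col {u, v}\<close> outside \<open>T\<close> for each pair of elements of \<open>T\<close>. The paths \<open>u, col {u, v}, v\<close>
  are edge-disjoint precisely when pairs that share an element receive different vertices, that
  is, when \<open>col\<close> is a proper edge colouring of the complete graph on \<open>T\<close>. To keep the middle
  vertices away from \<open>T\<close>, pass to a bipartition \<open>A\<close>, \<open>B\<close> of the graph that is crossed by
  \<open>m \<ge> c n\<^sup>2\<close> edges, with \<open>card B \<le> card A\<close>; seek \<open>T\<close> in \<open>A\<close> and colours in \<open>B\<close>.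

  Write \<open>d(u, v)\<close> for the number of common neighbours of \<open>u\<close> and \<open>v\<close> in \<open>B\<close>. It would be too much
  to ask that \<open>d\<close> be large on all pairs of \<open>T\<close>. Greedy colouring in the order of
  increasing \<open>d\<close> needs much less: it suffices that for every \<open>k\<close> each \<open>u \<in> T\<close> has at most \<open>k/2\<close>
  partners \<open>v\<close> with \<open>d(u, v) \<le> k\<close>. All these conditions follow at once from a bound on one weight,
  namely that \<open>1/d(u, v)\<close> summed over the partners \<open>v\<close> of \<open>u\<close> in \<open>T\<close> is at most \<open>1/2\<close>
  (\<open>proper_colouring_by_common_neighbours\<close>).

  The weight \<open>1/d\<close> is natural because it behaves well on average over the neighbourhoods \<open>C w\<close> in \<open>A\<close>
  of the vertices \<open>w \<in> B\<close>. A pair \<open>u, v\<close> lies in exactly \<open>d(u, v)\<close> of them, and so contributes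
  \<open>1\<close> in total (or \<open>0\<close>). Hence the weights \<open>Q (C w)\<close> of all ordered pairs in \<open>C w\<close> add up
  to at most \<open>a\<^sup>2\<close>, with \<open>a = card A\<close>, while the sizes of the \<open>C w\<close> add up to \<open>m\<close>. A random subset of \<open>C w\<close> that
  contains each element with probability \<open>p\<close> has expected value \<open>p card (C w) - p\<^sup>2 Q (C w)\<close> of
  size minus weight. Averaging over \<open>w\<close> and taking \<open>p = m / (2 a\<^sup>2)\<close> produces a \<open>w\<close> for which this is
  at least \<open>m\<^sup>2 / (4 a\<^sup>2 b)\<close>, with \<open>b = card B\<close>. If \<open>T\<close> is a subset of this \<open>C w\<close> that maximises size minus
  weight, then \<open>T\<close> is at least that large, and the weight bound of \<open>1/2\<close> holds at each \<open>u \<in> T\<close>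
  because the removal of \<open>u\<close> would lower the size by \<open>1\<close> and the weight by twice the weight at \<open>u\<close>
  (\<open>large_set_with_small_inverse_codegrees\<close>). Finally \<open>4 a\<^sup>2 b \<le> n\<^sup>3\<close>, as \<open>4 a b \<le> n\<^sup>2\<close> and
  \<open>a \<le> n\<close>; so the size is at least \<open>c\<^sup>2 n\<close>.
\<close>

section \<open>Subsets that do as well as random ones\<close>

text \<open>
  The left-hand side is the expectation of the right-hand side over a random \<open>S\<close> that contains
  each element of \<open>N\<close> independently with probability \<open>p\<close>. Instead of a probability space, the
  proof uses conditional expectations, deciding one element \<open>z\<close> at a time: choosing \<open>z\<close>
  turns its interactions with the other elements into a change of \<open>f\<close>, which is why \<open>f\<close> is
  general. Both the bipartition and the branch set are obtained from this lemma.
\<close>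

lemma random_subset_rounding:
  fixes f :: "'a \<Rightarrow> real" and \<omega> :: "'a \<Rightarrow> 'a \<Rightarrow> real"
  assumes "finite N" "0 \<le> p" "p \<le> 1"
  shows "\<exists>S \<subseteq> N. p * sum f N - p^2 * (\<Sum>x\<in>N. \<Sum>y\<in>N-{x}. \<omega> x y)
           \<le> sum f S - (\<Sum>x\<in>S. \<Sum>y\<in>S-{x}. \<omega> x y)"
  using assms(1)
proof (induction N arbitrary: f rule: finite_induct)
  case empty
  show ?case by simp
next
  case (insert z N)
  define Q where "Q S = (\<Sum>x\<in>S. \<Sum>y\<in>S-{x}. \<omega> x y)" for S
  define g where "g y = \<omega> z y + \<omega> y z" for y
  have Q_insert: "Q (insert z S) = Q S + sum g S" if "S \<subseteq> N" for S
  proof -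
    have fin: "finite S" and z: "z \<notin> S"
      using that insert.hyps finite_subset by auto
    have "(\<Sum>y\<in>insert z S-{x}. \<omega> x y) = \<omega> x z + (\<Sum>y\<in>S-{x}. \<omega> x y)" if "x \<in> S" for x
    proof -
      have "insert z S - {x} = insert z (S - {x})" using z that by auto
      then show ?thesis using fin z by simp
    qed
    moreover have "insert z S - {z} = S" using z by auto
    ultimately show ?thesis
      using fin z by (simp add: Q_def g_def sum.distrib)
  qed
  obtain S0 where S0: "S0 \<subseteq> N" "p * sum f N - p^2 * Q N \<le> sum f S0 - Q S0"
    using insert.IH[of f] unfolding Q_def by blast
  obtain S1 where S1: "S1 \<subseteq> N"
    "p * sum (\<lambda>y. f y - g y) N - p^2 * Q N \<le> sum (\<lambda>y. f y - g y) S1 - Q S1"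
    using insert.IH[of "\<lambda>y. f y - g y"] unfolding Q_def by blast
  have fin1: "finite S1" and z1: "z \<notin> S1"
    using S1 insert.hyps finite_subset by auto
  let ?v0 = "p * sum f N - p^2 * Q N"
  let ?v1 = "f z + (p * sum (\<lambda>y. f y - g y) N - p^2 * Q N)"
  \<comment> \<open>Conditioning on whether \<open>z\<close> is chosen writes the value for \<open>insert z N\<close> as a
    convex combination of two values for \<open>N\<close>.\<close>
  have conv: "p * sum f (insert z N) - p^2 * Q (insert z N) = (1 - p) * ?v0 + p * ?v1"
    using insert.hyps Q_insert[of N]
    by (simp add: sum_subtractf algebra_simps power2_eq_square)
  have "\<exists>S\<subseteq>insert z N. p * sum f (insert z N) - p^2 * Q (insert z N) \<le> sum f S - Q S"
  proof (cases "?v0 \<le> ?v1")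
    case True
    have "(1 - p) * ?v0 + p * ?v1 \<le> (1 - p) * ?v1 + p * ?v1"
      using True assms by (intro add_right_mono mult_left_mono) auto
    also have "\<dots> = ?v1" by (simp add: algebra_simps)
    also have "\<dots> \<le> sum f (insert z S1) - Q (insert z S1)"
      using S1 Q_insert[OF S1(1)] fin1 z1 by (simp add: sum_subtractf)
    finally show ?thesis using conv S1(1) by (intro exI[of _ "insert z S1"]) auto
  next
    case False
    have "(1 - p) * ?v0 + p * ?v1 \<le> (1 - p) * ?v0 + p * ?v0"
      using False assms by (intro add_left_mono mult_left_mono) auto
    also have "\<dots> = ?v0" by (simp add: algebra_simps)
    finally show ?thesis using conv S0 by (intro exI[of _ S0]) auto
  qed
  then show ?case unfolding Q_def .
qed

section \<open>A bipartition crossed by half of the edges\<close>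

lemma handshake:
  assumes "simple_graph G"
  shows "(\<Sum>u\<in>verts G. card {v \<in> verts G. {u, v} \<in> edges G}) = 2 * card (edges G)"
proof -
  have V: "finite (verts G)" and E: "\<And>e. e \<in> edges G \<Longrightarrow> e \<subseteq> verts G \<and> card e = 2"
    using assms by (auto simp: simple_graph_def)
  have finE: "finite (edges G)"
    by (rule finite_subset[of _ "Pow (verts G)"]) (use V E in auto)
  have "(\<Sum>u\<in>verts G. card {v \<in> verts G. {u, v} \<in> edges G})
      = card (SIGMA u:verts G. {v \<in> verts G. {u, v} \<in> edges G})"
    using V by simp
  also have "(SIGMA u:verts G. {v \<in> verts G. {u, v} \<in> edges G})
      = (\<Union>e\<in>edges G. {(u, v). {u, v} = e})"
    using E by auto
  also have "card \<dots> = (\<Sum>e\<in>edges G. card {(u, v). {u, v} = e})"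
  proof (rule card_UN_disjoint[OF finE])
    show "\<forall>e\<in>edges G. finite {(u, v). {u, v} = e}"
    proof
      fix e assume "e \<in> edges G"
      then have "finite e" using E finite_subset[OF _ V] by blast
      then have "finite (e \<times> e)" by simp
      then show "finite {(u, v). {u, v} = e}" by (rule rev_finite_subset) auto
    qed
  qed auto
  also have "\<dots> = (\<Sum>e\<in>edges G. 2)"
  proof (rule sum.cong[OF refl])
    fix e assume "e \<in> edges G"
    then obtain x y where "e = {x, y}" "x \<noteq> y" using E card_2_iff by metis
    then have "{(u, v). {u, v} = e} = {(x, y), (y, x)}" by (auto simp: doubleton_eq_iff)
    then show "card {(u, v). {u, v} = e} = 2" using \<open>x \<noteq> y\<close> by simp
  qed
  finally show ?thesis by simp
qed

text \<open>
  The number of edges that leave \<open>S\<close> is the sum of the degrees over \<open>S\<close> minus the number of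
  ordered adjacent pairs in \<open>S\<close>, so \<open>random_subset_rounding\<close> applies to it. With \<open>p = 1/2\<close> and
  \<open>e\<close> edges the value is \<open>1/2 * 2e - 1/4 * 2e = e/2\<close>. The two sides can be exchanged, so the
  larger one may be called \<open>A\<close>.
\<close>

lemma cut_with_half_the_edges:
  assumes G: "simple_graph G"
  obtains A B where "A \<union> B = verts G" "A \<inter> B = {}" "card B \<le> card A"
    "card (edges G) \<le> 2 * (\<Sum>u\<in>A. card {w \<in> B. {u, w} \<in> edges G})"
proof -
  define cut where "cut A B = (\<Sum>u\<in>A. card {w \<in> B. {u, w} \<in> edges G})" for A B
  have V: "finite (verts G)" and loopless: "\<And>u. {u} \<notin> edges G"
    using G by (auto simp: simple_graph_def)
  have card_of_bool: "real (card {w \<in> B. {u, w} \<in> edges G}) = (\<Sum>w\<in>B. of_bool ({u, w} \<in> edges G))"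
    if "finite B" for u B
    using that by (simp add: Int_def)
  define \<omega> :: "'a \<Rightarrow> 'a \<Rightarrow> real" where "\<omega> u v = of_bool ({u, v} \<in> edges G)" for u v
  have drop_diag: "(\<Sum>v\<in>S-{u}. \<omega> u v) = (\<Sum>v\<in>S. \<omega> u v)" if "S \<subseteq> verts G" for u S
    using loopless[of u] V that
    by (intro sum.mono_neutral_left) (auto simp: \<omega>_def intro: finite_subset)
  define f where "f u = (\<Sum>v\<in>verts G. \<omega> u v)" for u
  have total: "sum f (verts G) = 2 * real (card (edges G))"
    unfolding f_def \<omega>_def
    using arg_cong[OF handshake[OF G], of real] by (simp add: card_of_bool[OF V])
  obtain S where S: "S \<subseteq> verts G"
    "1/2 * sum f (verts G) - (1/2)^2 * (\<Sum>x\<in>verts G. \<Sum>y\<in>verts G-{x}. \<omega> x y)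
           \<le> sum f S - (\<Sum>x\<in>S. \<Sum>y\<in>S-{x}. \<omega> x y)"
    using random_subset_rounding[OF V, of "1/2" f \<omega>] by auto
  have "sum f S - (\<Sum>x\<in>S. \<Sum>y\<in>S-{x}. \<omega> x y) = (\<Sum>x\<in>S. f x - (\<Sum>y\<in>S. \<omega> x y))"
    by (simp add: drop_diag[OF S(1)] sum_subtractf)
  also have "\<dots> = (\<Sum>x\<in>S. \<Sum>y\<in>verts G - S. \<omega> x y)"
    unfolding f_def by (simp add: sum_diff[OF V S(1)])
  also have "\<dots> = real (cut S (verts G - S))"
    unfolding cut_def \<omega>_def by (simp only: of_nat_sum card_of_bool[OF finite_Diff[OF V]])
  finally have half: "card (edges G) \<le> 2 * cut S (verts G - S)"
    using S(2) total by (simp add: drop_diag f_def power2_eq_square)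
  have finS: "finite S" using S V finite_subset by auto
  have "real (cut S (verts G - S)) = real (cut (verts G - S) S)"
    unfolding cut_def of_nat_sum card_of_bool[OF finite_Diff[OF V]] card_of_bool[OF finS]
    by (subst sum.swap) (simp only: insert_commute)
  then have swap: "cut S (verts G - S) = cut (verts G - S) S" by simp
  show ?thesis
  proof (cases "card (verts G - S) \<le> card S")
    case True
    then show ?thesis using that[of S "verts G - S"] S half by (auto simp: cut_def)
  next
    case False
    then show ?thesis using that[of "verts G - S" S] S half swap by (auto simp: cut_def)
  qed
qed

section \<open>Greedy list colouring\<close>

text \<open>
  Each \<open>e\<close> only has to avoid the colours of those conflicting elements that are coloured before
  it, and their lists are no longer than its own.
\<close>

lemma list_colouring_by_increasing_list_size:
  assumes "finite E" and "\<And>e. e \<in> E \<Longrightarrow> finite (L e)"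
    and "\<And>e e'. conflict e e' \<Longrightarrow> conflict e' e"
    and "\<And>e. e \<in> E \<Longrightarrow>
      card {e' \<in> E. e' \<noteq> e \<and> conflict e' e \<and> card (L e') \<le> card (L e)} < card (L e)"
  shows "\<exists>col. (\<forall>e\<in>E. col e \<in> L e) \<and>
      (\<forall>e\<in>E. \<forall>e'\<in>E. e \<noteq> e' \<and> conflict e e' \<longrightarrow> col e \<noteq> col e')"
  using assms(1,2,4)
proof (induction E rule: finite_ranking_induct[where f = "\<lambda>e. card (L e)"])
  case empty
  show ?case by simp
next
  case (insert x S)
  show ?case
  proof (cases "x \<in> S")
    case True
    then have same: "insert x S = S" by blast
    show ?thesis unfolding same
      by (rule insert.IH) (fact insert.prems[unfolded same])+
  next
    case False
    have fewer: "card {e' \<in> S. e' \<noteq> e \<and> conflict e' e \<and> card (L e') \<le> card (L e)} < card (L e)"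
      if "e \<in> S" for e
      by (rule le_less_trans[OF card_mono insert.prems(2)[of e]])
         (use that insert.hyps(1) in auto)
    have "\<exists>col. (\<forall>e\<in>S. col e \<in> L e) \<and>
        (\<forall>e\<in>S. \<forall>e'\<in>S. e \<noteq> e' \<and> conflict e e' \<longrightarrow> col e \<noteq> col e')"
      by (rule insert.IH) (simp_all add: insert.prems(1) fewer)
    then obtain col where col: "\<And>e. e \<in> S \<Longrightarrow> col e \<in> L e"
      "\<And>e e'. e \<in> S \<Longrightarrow> e' \<in> S \<Longrightarrow> e \<noteq> e' \<Longrightarrow> conflict e e' \<Longrightarrow> col e \<noteq> col e'"
      by blast
    define D where "D = {e' \<in> S. conflict e' x}"
    have "D = {e' \<in> insert x S. e' \<noteq> x \<and> conflict e' x \<and> card (L e') \<le> card (L x)}"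
      using False insert.hyps by (auto simp: D_def)
    then have "card D < card (L x)" using insert.prems(2)[of x] by simp
    moreover have finD: "finite D" using insert.hyps by (simp add: D_def)
    ultimately have "card (col ` D) < card (L x)"
      using card_image_le[OF finD, of col] by linarith
    then have "\<not> L x \<subseteq> col ` D"
      using card_mono[of "col ` D" "L x"] finD by fastforce
    then obtain k where k: "k \<in> L x" "k \<notin> col ` D" by blast
    then have fresh: "k \<noteq> col e" if "e \<in> S" "conflict e x" for e
      using that by (auto simp: D_def)
    show ?thesis
    proof (intro exI[of _ "col(x := k)"] conjI ballI impI)
      fix e assume "e \<in> insert x S"
      then show "(col(x := k)) e \<in> L e" using k col by auto
    next
      fix e e' assume "e \<in> insert x S" "e' \<in> insert x S" "e \<noteq> e' \<and> conflict e e'"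
      then show "(col(x := k)) e \<noteq> (col(x := k)) e'"
        using fresh[of e] fresh[of e'] col(2)[of e e'] assms(3)[of e e'] by auto
    qed
  qed
qed

text \<open>
  The weight bound gives \<open>u\<close> at most \<open>k/2\<close> partners with at most \<open>k\<close> common neighbours, since each
  contributes at least \<open>1/k\<close>. If \<open>{u, v}\<close> has a list of size \<open>k\<close>, then \<open>v\<close> is itself one of
  these partners of \<open>u\<close>, and vice versa; so at most \<open>2 (k/2 - 1) < k\<close> pairs that meet \<open>{u, v}\<close> are
  coloured before it. The vertex \<open>w\<close> guarantees that no list is empty: an empty list would have
  weight \<open>1/0 = 0\<close> and escape the bound.
\<close>

lemma proper_colouring_by_common_neighbours:
  fixes N :: "'a \<Rightarrow> 'b set"
  assumes T: "finite T" and N: "\<And>u. u \<in> T \<Longrightarrow> finite (N u)" "\<And>u. u \<in> T \<Longrightarrow> w \<in> N u"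
    and deg: "\<And>u. u \<in> T \<Longrightarrow> (\<Sum>v\<in>T-{u}. 1 / real (card (N u \<inter> N v))) \<le> 1/2"
  obtains col where
    "\<And>u v. u \<in> T \<Longrightarrow> v \<in> T \<Longrightarrow> u \<noteq> v \<Longrightarrow> col {u, v} \<in> N u \<inter> N v"
    "\<And>u v v'. u \<in> T \<Longrightarrow> v \<in> T \<Longrightarrow> v' \<in> T \<Longrightarrow> u \<noteq> v \<Longrightarrow> u \<noteq> v' \<Longrightarrow> v \<noteq> v' \<Longrightarrow>
       col {u, v} \<noteq> col {u, v'}"
proof -
  define E where "E = {e. e \<subseteq> T \<and> card e = 2}"
  define L where "L e = (\<Inter>u\<in>e. N u)" for e
  have L: "L {u, v} = N u \<inter> N v" for u v by (simp add: L_def)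
  have finE: "finite E" using T by (simp add: E_def)
  have pos: "card (L {u, v}) > 0" if "u \<in> T" "v \<in> T" for u v
  proof -
    have "w \<in> L {u, v}" "finite (L {u, v})" using that N by (auto simp: L)
    then show ?thesis by (auto simp: card_gt_0_iff)
  qed
  have few: "2 * card {v \<in> T - {u}. card (L {u, v}) \<le> k} \<le> k" if u: "u \<in> T" for u k
  proof (cases "k = 0")
    case True
    then have "{v \<in> T - {u}. card (L {u, v}) \<le> k} = {}" using pos[OF u] by fastforce
    then show ?thesis by (simp only: card.empty mult_0_right le0)
  next
    case False
    define D where "D = {v \<in> T - {u}. card (L {u, v}) \<le> k}"
    have "real (card D) * (1 / real k) = (\<Sum>v\<in>D. 1 / real k)" by simp
    also have "\<dots> \<le> (\<Sum>v\<in>D. 1 / real (card (N u \<inter> N v)))"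
    proof (rule sum_mono)
      fix v assume "v \<in> D"
      then have "0 < card (N u \<inter> N v)" "card (N u \<inter> N v) \<le> k"
        using pos[OF u, of v] by (auto simp: D_def L)
      then show "1 / real k \<le> 1 / real (card (N u \<inter> N v))"
        by (intro divide_left_mono) auto
    qed
    also have "\<dots> \<le> (\<Sum>v\<in>T-{u}. 1 / real (card (N u \<inter> N v)))"
      using T by (intro sum_mono2) (auto simp: D_def)
    also have "\<dots> \<le> 1/2" by (rule deg[OF u])
    finally have "2 * real (card D) \<le> real k" using False by (simp add: divide_simps)
    then show ?thesis unfolding D_def by linarith
  qed
  have "\<exists>col. (\<forall>e\<in>E. col e \<in> L e) \<and>
      (\<forall>e\<in>E. \<forall>e'\<in>E. e \<noteq> e' \<and> e \<inter> e' \<noteq> {} \<longrightarrow> col e \<noteq> col e')"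
  proof (rule list_colouring_by_increasing_list_size[OF finE])
    fix e assume "e \<in> E"
    then obtain u v where e: "e = {u, v}" "u \<noteq> v" "u \<in> T" "v \<in> T"
      by (auto simp: E_def card_2_iff)
    show "finite (L e)" using e N by (simp add: L)
    define k where "k = card (L e)"
    define D where "D x = {y \<in> T - {x}. card (L {x, y}) \<le> k}" for x
    have finD: "finite (D x)" for x using T by (simp add: D_def)
    have uv: "v \<in> D u" "u \<in> D v" using e by (auto simp: D_def k_def insert_commute)
    have "{e' \<in> E. e' \<noteq> e \<and> e' \<inter> e \<noteq> {} \<and> card (L e') \<le> card (L e)}
        \<subseteq> (\<lambda>y. {u, y}) ` (D u - {v}) \<union> (\<lambda>y. {v, y}) ` (D v - {u})"
    proof
      fix e' assume "e' \<in> {e' \<in> E. e' \<noteq> e \<and> e' \<inter> e \<noteq> {} \<and> card (L e') \<le> card (L e)}"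
      then have e': "e' \<subseteq> T" "card e' = 2" "e' \<noteq> e" "e' \<inter> e \<noteq> {}" "card (L e') \<le> k"
        by (auto simp: E_def k_def)
      then obtain x where x: "x \<in> e'" "x = u \<or> x = v" using e by auto
      obtain y where y: "e' = {x, y}" "x \<noteq> y"
        using e'(2) x(1) by (auto simp: card_2_iff insert_commute)
      show "e' \<in> (\<lambda>y. {u, y}) ` (D u - {v}) \<union> (\<lambda>y. {v, y}) ` (D v - {u})"
        using x(2)
      proof
        assume "x = u"
        then have "y \<in> D u - {v}" using e' e y by (auto simp: D_def)
        then show ?thesis using y \<open>x = u\<close> by blast
      next
        assume "x = v"
        then have "y \<in> D v - {u}" using e' e y by (auto simp: D_def insert_commute)
        then show ?thesis using y \<open>x = v\<close> by blast
      qed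
    qed
    then have "card {e' \<in> E. e' \<noteq> e \<and> e' \<inter> e \<noteq> {} \<and> card (L e') \<le> card (L e)}
        \<le> card ((\<lambda>y. {u, y}) ` (D u - {v}) \<union> (\<lambda>y. {v, y}) ` (D v - {u}))"
      using finD by (intro card_mono) auto
    also have "\<dots> \<le> card ((\<lambda>y. {u, y}) ` (D u - {v})) + card ((\<lambda>y. {v, y}) ` (D v - {u}))"
      by (rule card_Un_le)
    also have "\<dots> \<le> card (D u - {v}) + card (D v - {u})"
      using finD by (intro add_mono card_image_le) auto
    also have "\<dots> = (card (D u) - 1) + (card (D v) - 1)" using uv finD by simp
    also have "\<dots> < k"
      using few[OF e(3), of k] few[OF e(4), of k] pos[OF e(3,4)] e(1)
      unfolding D_def[symmetric] k_def[symmetric] by (auto simp: k_def)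
    finally show "card {e' \<in> E. e' \<noteq> e \<and> e' \<inter> e \<noteq> {} \<and> card (L e') \<le> card (L e)}
        < card (L e)" unfolding k_def .
  qed auto
  then obtain col where col: "\<forall>e\<in>E. col e \<in> L e"
    "\<forall>e\<in>E. \<forall>e'\<in>E. e \<noteq> e' \<and> e \<inter> e' \<noteq> {} \<longrightarrow> col e \<noteq> col e'"
    by (elim exE conjE)
  have E: "{u, v} \<in> E" if "u \<in> T" "v \<in> T" "u \<noteq> v" for u v
    using that by (simp add: E_def)
  show ?thesis
  proof (rule that[of col])
    show "col {u, v} \<in> N u \<inter> N v" if "u \<in> T" "v \<in> T" "u \<noteq> v" for u v
      using bspec[OF col(1) E[OF that]] by (simp add: L)
    show "col {u, v} \<noteq> col {u, v'}"
      if "u \<in> T" "v \<in> T" "v' \<in> T" "u \<noteq> v" "u \<noteq> v'" "v \<noteq> v'" for u v v'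
      by (rule col(2)[rule_format, OF E[OF that(1,2,4)] E[OF that(1,3,5)]])
         (use that in \<open>auto simp: doubleton_eq_iff\<close>)
  qed
qed

section \<open>A large set of vertices of small weight\<close>

text \<open>
  The inverse codegree is the weight for which every pair contributes at most \<open>1\<close> to the total
  over all neighbourhoods. The common neighbour \<open>w\<close> is part of the conclusion because pairs
  without common neighbours have weight \<open>1/0 = 0\<close>, and only membership in a neighbourhood
  excludes them.
\<close>

lemma large_set_with_small_inverse_codegrees:
  fixes A :: "'a set" and B :: "'b set" and N :: "'a \<Rightarrow> 'b set"
  assumes A: "finite A" and B: "finite B" and N: "\<And>u. u \<in> A \<Longrightarrow> N u \<subseteq> B"
    and m: "m = (\<Sum>u\<in>A. card (N u))" "m > 0" and ba: "card B \<le> card A"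
  obtains w T where "w \<in> B" "T \<subseteq> A" "\<And>u. u \<in> T \<Longrightarrow> w \<in> N u"
    "real m ^ 2 / (4 * real (card A) ^ 2 * real (card B)) \<le> real (card T)"
    "\<And>u. u \<in> T \<Longrightarrow> (\<Sum>v\<in>T-{u}. 1 / real (card (N u \<inter> N v))) \<le> 1/2"
proof -
  define a where "a = real (card A)"
  define b where "b = real (card B)"
  define \<omega> where "\<omega> u v = 1 / real (card (N u \<inter> N v))" for u v
  define Q where "Q S = (\<Sum>x\<in>S. \<Sum>y\<in>S-{x}. \<omega> x y)" for S
  define C where "C w = {u \<in> A. w \<in> N u}" for w
  \<comment> \<open>This \<open>p\<close> maximises \<open>p * m - p^2 * a^2\<close>. It is at most \<open>1\<close> because \<open>m \<le> a * b\<close> and \<open>b \<le> a\<close>.\<close>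
  define p where "p = real m / (2 * a^2)"
  have mab: "real m \<le> a * b"
  proof -
    have "m \<le> (\<Sum>u\<in>A. card B)" unfolding m using N B by (intro sum_mono card_mono) auto
    then show ?thesis by (simp add: a_def b_def flip: of_nat_mult)
  qed
  have ab: "a > 0" "b > 0" "b \<le> a"
    using mab m(2) ba by (auto simp: a_def b_def intro!: gr0I)
  have "a * b \<le> a * a" using ab by (intro mult_left_mono) auto
  then have "real m \<le> 2 * a^2"
    using mab zero_le_power2[of a] unfolding power2_eq_square by linarith
  then have p: "0 \<le> p" "p \<le> 1"
    using ab by (auto simp: p_def divide_simps)
  have finC: "finite (C w)" for w using A by (simp add: C_def)
  have incidences: "(\<Sum>w\<in>B. real (card (C w))) = real m"
  proof -
    have "(\<Sum>w\<in>B. real (card (C w))) = (\<Sum>w\<in>B. \<Sum>u\<in>A. of_bool (w \<in> N u))"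
      using A by (simp add: C_def Int_def)
    also have "\<dots> = (\<Sum>u\<in>A. \<Sum>w\<in>B. of_bool (w \<in> N u))" by (rule sum.swap)
    also have "\<dots> = (\<Sum>u\<in>A. real (card (N u)))"
    proof (rule sum.cong[OF refl])
      fix u assume "u \<in> A"
      then have "{w \<in> B. w \<in> N u} = N u" using N by auto
      then show "(\<Sum>w\<in>B. of_bool (w \<in> N u)) = real (card (N u))"
        using B by (simp add: Int_def)
    qed
    finally show ?thesis by (simp add: m)
  qed
  have weights: "(\<Sum>w\<in>B. Q (C w)) \<le> a^2"
  proof -
    have "(\<Sum>w\<in>B. Q (C w))
        = (\<Sum>w\<in>B. \<Sum>u\<in>A. \<Sum>v\<in>A. of_bool (w \<in> N u \<and> w \<in> N v \<and> v \<noteq> u) * \<omega> u v)"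
    proof (rule sum.cong[OF refl])
      fix w
      have "(\<Sum>u\<in>A. \<Sum>v\<in>A. of_bool (w \<in> N u \<and> w \<in> N v \<and> v \<noteq> u) * \<omega> u v)
          = (\<Sum>u\<in>C w. \<Sum>v\<in>A. of_bool (w \<in> N u \<and> w \<in> N v \<and> v \<noteq> u) * \<omega> u v)"
        using A by (intro sum.mono_neutral_right) (auto simp: C_def)
      also have "\<dots> = Q (C w)"
        unfolding Q_def
      proof (rule sum.cong[OF refl])
        fix u assume "u \<in> C w"
        then show "(\<Sum>v\<in>A. of_bool (w \<in> N u \<and> w \<in> N v \<and> v \<noteq> u) * \<omega> u v)
            = (\<Sum>v\<in>C w - {u}. \<omega> u v)"
          using A by (intro sum.mono_neutral_cong_right) (auto simp: C_def)
      qed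
      finally show "Q (C w)
          = (\<Sum>u\<in>A. \<Sum>v\<in>A. of_bool (w \<in> N u \<and> w \<in> N v \<and> v \<noteq> u) * \<omega> u v)" by simp
    qed
    also have "\<dots> = (\<Sum>u\<in>A. \<Sum>v\<in>A. \<Sum>w\<in>B. of_bool (w \<in> N u \<and> w \<in> N v \<and> v \<noteq> u) * \<omega> u v)"
      by (subst sum.swap, intro sum.cong[OF refl] sum.swap)
    also have "\<dots> \<le> (\<Sum>u\<in>A. \<Sum>v\<in>A. 1)"
    proof (intro sum_mono)
      fix u v assume uv: "u \<in> A" "v \<in> A"
      have "(\<Sum>w\<in>B. of_bool (w \<in> N u \<and> w \<in> N v \<and> v \<noteq> u) * \<omega> u v)
          \<le> (\<Sum>w\<in>B. of_bool (w \<in> N u \<inter> N v) * \<omega> u v)"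
        by (intro sum_mono mult_right_mono) (auto simp: \<omega>_def)
      also have "\<dots> = (\<Sum>w\<in>B. of_bool (w \<in> N u \<inter> N v)) * \<omega> u v"
        by (simp add: sum_distrib_right)
      also have "(\<Sum>w\<in>B. of_bool (w \<in> N u \<inter> N v)) = real (card (N u \<inter> N v))"
      proof -
        have "{w \<in> B. w \<in> N u \<and> w \<in> N v} = N u \<inter> N v" using N uv by auto
        then show ?thesis using B by (simp add: Int_def)
      qed
      also have "\<dots> * \<omega> u v \<le> 1" by (simp add: \<omega>_def)
      finally show "(\<Sum>w\<in>B. of_bool (w \<in> N u \<and> w \<in> N v \<and> v \<noteq> u) * \<omega> u v) \<le> 1" .
    qed
    also have "\<dots> = a^2" by (simp add: a_def power2_eq_square)
    finally show ?thesis .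
  qed
  define t where "t = real m ^ 2 / (4 * a^2 * b)"
  have "\<exists>w\<in>B. t \<le> p * real (card (C w)) - p^2 * Q (C w)"
  proof (rule ccontr)
    assume "\<not> ?thesis"
    then have less: "\<And>w. w \<in> B \<Longrightarrow> p * real (card (C w)) - p^2 * Q (C w) < t" by force
    have "p * real m - p^2 * a^2 \<le> p * (\<Sum>w\<in>B. real (card (C w))) - p^2 * (\<Sum>w\<in>B. Q (C w))"
      using weights incidences by (simp add: mult_left_mono)
    also have "\<dots> = (\<Sum>w\<in>B. p * real (card (C w)) - p^2 * Q (C w))"
      by (simp add: sum_subtractf sum_distrib_left)
    also have "\<dots> < (\<Sum>w\<in>B. t)"
      using less ab(2) B by (intro sum_strict_mono) (auto simp: b_def)
    also have "\<dots> = b * t" by (simp add: b_def)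
    also have "b * t = p * real m - p^2 * a^2"
      using ab by (simp add: p_def t_def field_simps power2_eq_square)
    finally show False by simp
  qed
  then obtain w where w: "w \<in> B" "t \<le> p * real (card (C w)) - p^2 * Q (C w)" by blast
  \<comment> \<open>A maximal value of size minus weight cannot be increased by deleting a vertex; this gives the
    bound on the weight at each vertex.\<close>
  define F where "F S = real (card S) - Q S" for S
  have fin: "finite (F ` Pow (C w))" and "F ` Pow (C w) \<noteq> {}" using finC by auto
  then obtain T where T: "T \<in> Pow (C w)" "F T = Max (F ` Pow (C w))"
    using Max_in by (metis imageE)
  have T_max: "F S \<le> F T" if "S \<subseteq> C w" for S
    using that fin by (auto simp: T(2))
  have finT: "finite T" using T(1) finC finite_subset by auto
  obtain S where S: "S \<subseteq> C w"
    "p * real (card (C w)) - p^2 * Q (C w) \<le> F S"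
    using random_subset_rounding[OF finC p, of w "\<lambda>_. 1" \<omega>] unfolding Q_def F_def by auto
  have "0 \<le> Q T" unfolding Q_def by (intro sum_nonneg) (auto simp: \<omega>_def)
  then have size: "t \<le> real (card T)"
    using w(2) S T_max[of S] by (auto simp: F_def)
  have deg: "(\<Sum>v\<in>T-{u}. \<omega> u v) \<le> 1/2" if u: "u \<in> T" for u
  proof -
    define S where "S = T - {u}"
    have S: "T = insert u S" "u \<notin> S" "finite S" using u finT by (auto simp: S_def)
    have row: "(\<Sum>y\<in>insert u S-{x}. \<omega> x y) = \<omega> u x + (\<Sum>y\<in>S-{x}. \<omega> x y)" if "x \<in> S" for x
    proof -
      have "insert u S - {x} = insert u (S - {x})" using S that by auto
      then show ?thesis using S by (simp add: \<omega>_def Int_commute)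
    qed
    have "insert u S - {u} = S" using S by auto
    then have "Q T = Q S + 2 * (\<Sum>v\<in>S. \<omega> u v)"
      using S row by (simp add: Q_def sum.distrib)
    moreover have "card T = Suc (card S)" using S by simp
    moreover have "F S \<le> F T" using T(1) T_max[of S] by (auto simp: S_def)
    ultimately show ?thesis by (simp add: F_def S_def)
  qed
  show ?thesis
    using that[of w T] w(1) T(1) size deg
    by (auto simp: C_def t_def a_def b_def \<omega>_def)
qed

section \<open>From colourings to immersions\<close>

lemma path_edges_three: "path_edges [x, m, y] = {{x, m}, {m, y}}"
proof -
  have "{i. Suc i < length [x, m, y]} = {0, 1}" by auto
  then have "path_edges [x, m, y] = (\<lambda>i. {[x, m, y] ! i, [x, m, y] ! Suc i}) ` {0, 1}"
    unfolding path_edges_def by blast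
  then show ?thesis by simp
qed

lemma one_immersion_from_colouring:
  fixes G :: "'a ugraph"
  assumes T: "finite T" "T \<subseteq> verts G"
    and mid: "\<And>u v. u \<in> T \<Longrightarrow> v \<in> T \<Longrightarrow> u \<noteq> v \<Longrightarrow>
        col {u, v} \<in> verts G - T \<and> {u, col {u, v}} \<in> edges G"
    and proper: "\<And>u v v'. u \<in> T \<Longrightarrow> v \<in> T \<Longrightarrow> v' \<in> T \<Longrightarrow> u \<noteq> v \<Longrightarrow> u \<noteq> v' \<Longrightarrow> v \<noteq> v' \<Longrightarrow>
        col {u, v} \<noteq> col {u, v'}"
  shows "\<exists>(H :: nat ugraph) \<phi> P. complete_graph H \<and> card (verts H) = card T
           \<and> strong_immersion H G \<phi> P \<and> k_immersion 1 H G \<phi> P"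
proof -
  obtain \<phi> :: "nat \<Rightarrow> 'a" where \<phi>: "bij_betw \<phi> {0..<card T} T"
    using ex_bij_betw_nat_finite[OF T(1)] by blast
  define H :: "nat ugraph" where
    "H = \<lparr>verts = {0..<card T}, edges = {e. e \<subseteq> {0..<card T} \<and> card e = 2}\<rparr>"
  define P where "P e = [\<phi> (Min e), col (\<phi> ` e), \<phi> (Max e)]" for e
  have VH: "verts H = {0..<card T}" by (simp add: H_def)
  have im: "\<phi> ` verts H = T" and inj: "inj_on \<phi> (verts H)"
    using \<phi> by (auto simp: bij_betw_def VH)
  have edge: "\<exists>i j. e = {i, j} \<and> i < j \<and> i \<in> verts H \<and> j \<in> verts H
      \<and> P e = [\<phi> i, col {\<phi> i, \<phi> j}, \<phi> j] \<and> \<phi> i \<in> T \<and> \<phi> j \<in> T \<and> \<phi> i \<noteq> \<phi> j" if "e \<in> edges H" for e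
  proof -
    have e: "e \<subseteq> verts H" "card e = 2" using that by (auto simp: H_def)
    obtain i j where ij: "e = {i, j}" "i < j"
      using e(2) by (metis card_2_iff insert_commute linorder_neqE_nat)
    then have "i \<in> verts H" "j \<in> verts H" "\<phi> i \<noteq> \<phi> j"
      using e inj by (auto dest: inj_onD)
    then show ?thesis using ij im by (intro exI[of _ i] exI[of _ j]) (auto simp: P_def)
  qed
  have complete: "complete_graph H"
    by (auto simp: complete_graph_def simple_graph_def H_def)
  have path: "is_path G (P e)" if "e \<in> edges H" for e
  proof -
    obtain i j where ij: "P e = [\<phi> i, col {\<phi> i, \<phi> j}, \<phi> j]" "\<phi> i \<in> T" "\<phi> j \<in> T" "\<phi> i \<noteq> \<phi> j"
      using edge[OF \<open>e \<in> edges H\<close>] by blast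
    then show ?thesis
      using mid[of "\<phi> i" "\<phi> j"] mid[of "\<phi> j" "\<phi> i"] T(2)
      by (auto simp: is_path_def path_edges_three insert_commute)
  qed
  have joins: "path_joins (P {u, v}) (\<phi> u) (\<phi> v)" if "{u, v} \<in> edges H" for u v
    using edge[OF that] by (auto simp: path_joins_def doubleton_eq_iff)
  have internal: "\<exists>m. m \<notin> T \<and> internal_verts (P e) = {m}" if "e \<in> edges H" for e
    using edge[OF that] mid by (fastforce simp: internal_verts_def)
  \<comment> \<open>An edge of a path has exactly one end in \<open>T\<close>, so it determines that branch vertex
    and the middle vertex, and hence the path, because \<open>col\<close> is proper. The ends \<open>x\<close>, \<open>y\<close> are
    named so that the edge is the half of the path at \<open>x\<close>.\<close>
  have half_edge: "\<exists>x y. e = {x, y} \<and> x \<in> verts H \<and> y \<in> verts H \<and> \<phi> x \<noteq> \<phi> y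
      \<and> \<phi> x \<in> T \<and> \<phi> y \<in> T \<and> f = {\<phi> x, col {\<phi> x, \<phi> y}}"
    if "e \<in> edges H" "f \<in> path_edges (P e)" for e f
  proof -
    obtain i j where ij: "e = {i, j}" "i \<in> verts H" "j \<in> verts H"
      "P e = [\<phi> i, col {\<phi> i, \<phi> j}, \<phi> j]" "\<phi> i \<in> T" "\<phi> j \<in> T" "\<phi> i \<noteq> \<phi> j"
      using edge[OF \<open>e \<in> edges H\<close>] by blast
    then have "f = {\<phi> i, col {\<phi> i, \<phi> j}} \<or> f = {\<phi> j, col {\<phi> j, \<phi> i}}"
      using that(2) by (auto simp: path_edges_three insert_commute)
    then show ?thesis
    proof
      assume "f = {\<phi> i, col {\<phi> i, \<phi> j}}"
      then show ?thesis using ij by (intro exI[of _ i] exI[of _ j]) simp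
    next
      assume "f = {\<phi> j, col {\<phi> j, \<phi> i}}"
      moreover have "e = {j, i}" using ij by auto
      ultimately show ?thesis using ij by (intro exI[of _ j] exI[of _ i]) simp
    qed
  qed
  have disjoint: "disjoint_family_on (\<lambda>e. path_edges (P e)) (edges H)"
    unfolding disjoint_family_on_def
  proof (intro ballI impI equals0I)
    fix e e' f
    assume e: "e \<in> edges H" "e' \<in> edges H" "e \<noteq> e'"
      and f: "f \<in> path_edges (P e) \<inter> path_edges (P e')"
    obtain x y where xy: "e = {x, y}" "x \<in> verts H" "y \<in> verts H" "\<phi> x \<noteq> \<phi> y"
      "\<phi> x \<in> T" "\<phi> y \<in> T" "f = {\<phi> x, col {\<phi> x, \<phi> y}}"
      using half_edge[of e f] e f by blast
    obtain x' y' where xy': "e' = {x', y'}" "x' \<in> verts H" "y' \<in> verts H" "\<phi> x' \<noteq> \<phi> y'"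
      "\<phi> x' \<in> T" "\<phi> y' \<in> T" "f = {\<phi> x', col {\<phi> x', \<phi> y'}}"
      using half_edge[of e' f] e f by blast
    have same: "\<phi> x = \<phi> x'" "col {\<phi> x, \<phi> y} = col {\<phi> x', \<phi> y'}"
      using mid[of "\<phi> x" "\<phi> y"] mid[of "\<phi> x'" "\<phi> y'"] xy xy'
      by (auto simp: doubleton_eq_iff)
    then have "\<phi> y = \<phi> y'"
      using proper[of "\<phi> x" "\<phi> y" "\<phi> y'"] xy xy' by auto
    then have "e = e'" using same inj xy xy' by (auto dest: inj_onD)
    then show False using e by simp
  qed
  have imm: "immersion H G \<phi> P"
    using inj im T(2) path joins disjoint by (auto simp: immersion_def)
  have "strong_immersion H G \<phi> P"
    using imm internal im by (fastforce simp: strong_immersion_def)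
  moreover have "k_immersion 1 H G \<phi> P"
    using imm internal by (fastforce simp: k_immersion_def)
  moreover have "card (verts H) = card T" by (simp add: VH)
  ultimately show ?thesis using complete by blast
qed

section \<open>The immersion theorem\<close>

theorem theorem1p4:
  fixes G :: "'a ugraph" and n :: nat and c :: real
  assumes "simple_graph G"
    and "n > 0"
    and "c \<ge> 0"
    and "card (verts G) = n"
    and "real (card (edges G)) = 2 * c * (real n)^2"
  shows "\<exists>(H :: nat ugraph) \<phi> P. complete_graph H
           \<and> real (card (verts H)) \<ge> c^2 * real n
           \<and> strong_immersion H G \<phi> P \<and> k_immersion 1 H G \<phi> P"
proof (cases "c = 0")
  \<comment> \<open>For \<open>c = 0\<close> the cut may be empty; the empty complete graph is large enough.\<close>
  case True
  then show ?thesis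
    using one_immersion_from_colouring[of "{}" G undefined] by fastforce
next
  case False
  have V: "finite (verts G)" using assms(1) by (simp add: simple_graph_def)
  obtain A B where AB: "A \<union> B = verts G" "A \<inter> B = {}" "card B \<le> card A"
    "card (edges G) \<le> 2 * (\<Sum>u\<in>A. card {w \<in> B. {u, w} \<in> edges G})"
    using cut_with_half_the_edges[OF assms(1)] .
  have fin: "finite A" "finite B" using V AB(1) by (metis finite_Un)+
  define N where "N u = {w \<in> B. {u, w} \<in> edges G}" for u
  define m where "m = (\<Sum>u\<in>A. card (N u))"
  have m: "c * real n ^ 2 \<le> real m"
    using AB(4) assms(5) unfolding m_def N_def by linarith
  moreover have "c * real n ^ 2 > 0" using False assms by simp
  ultimately have mpos: "m > 0" by (auto intro!: gr0I)
  have NB: "N u \<subseteq> B" for u by (auto simp: N_def)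
  obtain w T where T: "w \<in> B" "T \<subseteq> A" "\<And>u. u \<in> T \<Longrightarrow> w \<in> N u"
    "real m ^ 2 / (4 * real (card A) ^ 2 * real (card B)) \<le> real (card T)"
    "\<And>u. u \<in> T \<Longrightarrow> (\<Sum>v\<in>T-{u}. 1 / real (card (N u \<inter> N v))) \<le> 1/2"
    by (rule large_set_with_small_inverse_codegrees[OF fin NB m_def mpos AB(3)])
       (rule that; simp)
  have finT: "finite T" using T(2) fin finite_subset by auto
  have finN: "finite (N u)" for u using fin by (simp add: N_def)
  obtain col where col:
    "\<And>u v. u \<in> T \<Longrightarrow> v \<in> T \<Longrightarrow> u \<noteq> v \<Longrightarrow> col {u, v} \<in> N u \<inter> N v"
    "\<And>u v v'. u \<in> T \<Longrightarrow> v \<in> T \<Longrightarrow> v' \<in> T \<Longrightarrow> u \<noteq> v \<Longrightarrow> u \<noteq> v' \<Longrightarrow> v \<noteq> v' \<Longrightarrow>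
       col {u, v} \<noteq> col {u, v'}"
    by (rule proper_colouring_by_common_neighbours[OF finT finN T(3) T(5)])
       (assumption | rule that; simp)+
  have "\<exists>(H :: nat ugraph) \<phi> P. complete_graph H \<and> card (verts H) = card T
           \<and> strong_immersion H G \<phi> P \<and> k_immersion 1 H G \<phi> P"
  proof (rule one_immersion_from_colouring[where col = col, OF finT])
    show "T \<subseteq> verts G" using T AB by auto
    show "col {u, v} \<in> verts G - T \<and> {u, col {u, v}} \<in> edges G"
      if "u \<in> T" "v \<in> T" "u \<noteq> v" for u v
      using col(1)[OF that] T(2) AB(1,2) by (auto simp: N_def)
    show "col {u, v} \<noteq> col {u, v'}"
      if "u \<in> T" "v \<in> T" "v' \<in> T" "u \<noteq> v" "u \<noteq> v'" "v \<noteq> v'" for u v v'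
      by (rule col(2)[OF that])
  qed
  moreover have "c^2 * real n \<le> real (card T)"
  proof -
    define a b where "a = real (card A)" and "b = real (card B)"
    have "card A + card B = n"
      using AB fin assms(4) card_Un_disjoint by metis
    then have abn: "a + b = real n" by (auto simp: a_def b_def)
    have pos: "a > 0" "b > 0"
      using T(1) AB(3) fin by (auto simp: a_def b_def card_gt_0_iff)
    \<comment> \<open>\<open>4 a b \<le> (a + b)\<^sup>2 = n\<^sup>2\<close>, multiplied by \<open>a \<le> n\<close>.\<close>
    have "4 * (a * b) \<le> (a + b)^2"
      using zero_le_power2[of "a - b"] by (simp add: power2_eq_square algebra_simps)
    then have "a * (4 * (a * b)) \<le> (a + b) * (a + b)^2"
      using pos by (intro mult_mono) auto
    then have vol: "4 * a^2 * b \<le> real n ^ 3"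
      using abn by (simp add: power2_eq_square power3_eq_cube algebra_simps)
    have "c^2 * real n = (c * real n ^ 2)^2 / real n ^ 3"
      using assms(2) by (simp add: power_mult_distrib field_simps eval_nat_numeral)
    also have "\<dots> \<le> real m ^ 2 / real n ^ 3"
      using m assms(3) by (intro divide_right_mono power_mono) auto
    also have "\<dots> \<le> real m ^ 2 / (4 * a^2 * b)"
      using vol pos assms(2) by (intro divide_left_mono) auto
    also have "\<dots> \<le> real (card T)" using T(4) by (simp add: a_def b_def)
    finally show ?thesis .
  qed
  ultimately show ?thesis by metis
qed

end
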